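(* Let $a,b\in\mathbb{R}$ be constants. The differential equation $y'=(x+a)^{-1}(y+b)$ (on a connected component of $\{x\neq -a\}$) admits a 4-dimensional Lie subgroup of $A(2,\mathbb{R})$, and it can be transformed to the equation $y'=x^{-1}y$ (on $\{x\ne 0\}$) by an element of $A(2,\mathbb{R})$.
   Context: $A(2,\mathbb{R})$ is the group of invertible affine transformations of $\mathbb{R}^2$ (a 6-dimensional Lie group). An equation $y'=f(x,y)$ with $f$ smooth on an open set $U\subset\mathbb{R}^2$ is identified with the Pfaffian system $\langle dy-f\,dx\rangle$, i.e. with the line field $\ell_f(p)=\ker(dy-f\,dx)_p$, $p\in U$. The equation $y'=f$ admits a Lie subgroup $H\subset A(2,\mathbb{R})$ if $dh_p(\ell_f(p))=\ell_f(h(p))$ for all $h\in H$ and all $p\in U$ with $h(p)\in U$. The equation $y'=f$ on $U$ can be transformed to $y'=F$ on $U'$ by an element of $A(2,\mathbb{R})$ if for each $p\in U$ there are a neighbourhood $V\subset U$ of $p$ and $g\in A(2,\mathbb{R})$ with $g(V)\subset U'$ and $dg_q(\ell_f(q))=\ell_F(g(q))$ for all $q\in V$. *)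

theory Defs
  imports "HOL-Analysis.Analysis" "HOL-Algebra.Group"
begin

section \<open>Smooth maps and manifolds\<close>

text \<open>\<open>C\<^sup>n\<close> on an open subset of a Euclidean space, by continuity of all iterated directional
  derivatives. Both notions are meant for open \<open>S\<close> only.\<close>

primrec Ck_on :: "nat \<Rightarrow> ('a::euclidean_space \<Rightarrow> 'b::euclidean_space) \<Rightarrow> 'a set \<Rightarrow> bool" where
  "Ck_on 0 f S \<longleftrightarrow> continuous_on S f"
| "Ck_on (Suc n) f S \<longleftrightarrow> (\<forall>x\<in>S. f differentiable (at x)) \<and>
     (\<forall>v. Ck_on n (\<lambda>x. frechet_derivative f (at x) v) S)"

definition smooth_on :: "('a::euclidean_space \<Rightarrow> 'b::euclidean_space) \<Rightarrow> 'a set \<Rightarrow> bool" where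
  "smooth_on f S \<longleftrightarrow> (\<forall>n. Ck_on n f S)"

text \<open>A chart is a pair of its domain and a coordinate map into the model space \<open>'e\<close>; the
  dimension is \<open>DIM('e)\<close>.\<close>

type_synonym ('a, 'e) chart = "'a set \<times> ('a \<Rightarrow> 'e)"

definition smooth_manifold :: "'a topology \<Rightarrow> ('a, 'e::euclidean_space) chart set \<Rightarrow> bool" where
  "smooth_manifold X \<A> \<longleftrightarrow>
     Hausdorff_space X \<and> second_countable X \<and>
     (\<Union>(W, \<phi>)\<in>\<A>. W) = topspace X \<and>
     (\<forall>(W, \<phi>)\<in>\<A>. openin X W \<and> open (\<phi> ` W) \<and>
        homeomorphic_map (subtopology X W) (top_of_set (\<phi> ` W)) \<phi>) \<and>
     (\<forall>(W, \<phi>)\<in>\<A>. \<forall>(V, \<psi>)\<in>\<A>. smooth_on (\<psi> \<circ> inv_into W \<phi>) (\<phi> ` (W \<inter> V)))"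

text \<open>The continuity of \<open>f\<close> makes the sets \<open>\<phi> ` (W \<inter> f -` V)\<close> open.\<close>

definition smooth_map ::
  "'a topology \<Rightarrow> ('a, 'e::euclidean_space) chart set \<Rightarrow>
   'b topology \<Rightarrow> ('b, 'd::euclidean_space) chart set \<Rightarrow> ('a \<Rightarrow> 'b) \<Rightarrow> bool" where
  "smooth_map X \<A> Y \<B> f \<longleftrightarrow> continuous_map X Y f \<and>
     (\<forall>(W, \<phi>)\<in>\<A>. \<forall>(V, \<psi>)\<in>\<B>. smooth_on (\<psi> \<circ> f \<circ> inv_into W \<phi>) (\<phi> ` (W \<inter> f -` V)))"

definition immersion ::
  "'a topology \<Rightarrow> ('a, 'e::euclidean_space) chart set \<Rightarrow>
   'b topology \<Rightarrow> ('b, 'd::euclidean_space) chart set \<Rightarrow> ('a \<Rightarrow> 'b) \<Rightarrow> bool" where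
  "immersion X \<A> Y \<B> f \<longleftrightarrow> smooth_map X \<A> Y \<B> f \<and>
     (\<forall>(W, \<phi>)\<in>\<A>. \<forall>(V, \<psi>)\<in>\<B>. \<forall>u\<in>\<phi> ` (W \<inter> f -` V).
        inj (frechet_derivative (\<psi> \<circ> f \<circ> inv_into W \<phi>) (at u)))"

definition prod_charts ::
  "('a, 'e) chart set \<Rightarrow> ('b, 'd) chart set \<Rightarrow> ('a \<times> 'b, 'e \<times> 'd) chart set" where
  "prod_charts \<A> \<B> = {(W \<times> V, map_prod \<phi> \<psi>) | W \<phi> V \<psi>. (W, \<phi>) \<in> \<A> \<and> (V, \<psi>) \<in> \<B>}"

section \<open>Lie groups and Lie subgroups\<close>

definition lie_group ::
  "('a, 'm) monoid_scheme \<Rightarrow> 'a topology \<Rightarrow> ('a, 'e::euclidean_space) chart set \<Rightarrow> bool" where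
  "lie_group G X \<A> \<longleftrightarrow> group G \<and> topspace X = carrier G \<and> smooth_manifold X \<A> \<and>
     smooth_map (prod_topology X X) (prod_charts \<A> \<A>) X \<A> (\<lambda>(g, h). g \<otimes>\<^bsub>G\<^esub> h) \<and>
     smooth_map X \<A> X \<A> (m_inv G)"

text \<open>Lie subgroups in the usual (immersed, not necessarily closed) sense: a subgroup carrying some
  Lie group structure, of dimension \<open>DIM('e)\<close>, for which the inclusion is an immersion.\<close>

definition lie_subgroup ::
  "'e::euclidean_space itself \<Rightarrow> 'a set \<Rightarrow> ('a, 'm) monoid_scheme \<Rightarrow>
   'a topology \<Rightarrow> ('a, 'd::euclidean_space) chart set \<Rightarrow> bool" where
  "lie_subgroup _ H G Y \<B> \<longleftrightarrow> subgroup H G \<and>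
     (\<exists>X. \<exists>\<A> :: ('a, 'e) chart set.
        lie_group (G\<lparr>carrier := H\<rparr>) X \<A> \<and> immersion X \<A> Y \<B> id)"

section \<open>The affine group of the plane\<close>

text \<open>The pair \<open>(A, v)\<close> stands for the transformation \<open>p \<mapsto> A p + v\<close>, so \<open>A(2,\<real>)\<close> is an open
  subset of the 6-dimensional space of such pairs, which serves as its only chart.\<close>

type_synonym affine2 = "(real^2^2) \<times> (real^2)"

definition aff :: "affine2 \<Rightarrow> real^2 \<Rightarrow> real^2" where
  "aff g p = fst g *v p + snd g"

definition A2 :: "affine2 monoid" where
  "A2 = \<lparr>carrier = {(A, v). invertible A},
         mult = (\<lambda>(A, v) (B, w). (A ** B, A *v w + v)),
         one = (mat 1, 0)\<rparr>"

definition A2_topology :: "affine2 topology" where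
  "A2_topology = top_of_set (carrier A2)"

definition A2_charts :: "(affine2, affine2) chart set" where
  "A2_charts = {(carrier A2, id)}"

lemma aff_mult: "aff (g \<otimes>\<^bsub>A2\<^esub> h) = aff g \<circ> aff h"
  by (auto simp: aff_def A2_def fun_eq_iff matrix_vector_mul_assoc matrix_vector_right_distrib
      split: prod.splits)

lemma aff_one: "aff \<one>\<^bsub>A2\<^esub> = id"
  by (simp add: aff_def A2_def fun_eq_iff)

section \<open>First-order equations as line fields\<close>

text \<open>The equation \<open>y' = f(x, y)\<close>, where \<open>x = p $ 1\<close> and \<open>y = p $ 2\<close>, is given by the smooth
  function \<open>f\<close> of \<open>p\<close> on the open set \<open>U\<close>. Its line at \<open>p\<close> is the kernel of \<open>dy - f dx\<close>.\<close>

definition line_field :: "(real^2 \<Rightarrow> real) \<Rightarrow> real^2 \<Rightarrow> (real^2) set" where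
  "line_field f p = {v. v $ 2 - f p * v $ 1 = 0}"

definition admits :: "(real^2 \<Rightarrow> real) \<Rightarrow> (real^2) set \<Rightarrow> affine2 set \<Rightarrow> bool" where
  "admits f U H \<longleftrightarrow> (\<forall>h\<in>H. \<forall>p\<in>U. aff h p \<in> U \<longrightarrow>
     frechet_derivative (aff h) (at p) ` line_field f p = line_field f (aff h p))"

definition transformable ::
  "(real^2 \<Rightarrow> real) \<Rightarrow> (real^2) set \<Rightarrow> (real^2 \<Rightarrow> real) \<Rightarrow> (real^2) set \<Rightarrow> bool" where
  "transformable f U F U' \<longleftrightarrow> (\<forall>p\<in>U. \<exists>V. \<exists>g\<in>carrier A2.
     open V \<and> p \<in> V \<and> V \<subseteq> U \<and> aff g ` V \<subseteq> U' \<and>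
     (\<forall>q\<in>V. frechet_derivative (aff g) (at q) ` line_field f q = line_field F (aff g q)))"

end

(* All solution curves of y' = (y + b) / (x + a) are lines through the point (-a, -b), so the line
   at p is spanned by p - (-a, -b), and every affine map fixing (-a, -b) preserves the line field.
   These maps form a conjugate of GL(2, R), which has dimension 4. Translating (-a, -b) to the
   origin gives y' = y / x. *)
theory Submission
  imports Defs
begin

section \<open>Closure of the C^n maps on an open set under sums, products and reciprocals\<close>

section \<open>Calculus of \<open>C\<^sup>n\<close> maps\<close>

text \<open>Agreement on an open set is agreement near each of its points, so the derivatives agree
  on \<open>S\<close> too and the induction passes to them.\<close>

lemma Ck_on_cong:
  assumes "open S" "\<And>x. x \<in> S \<Longrightarrow> f x = g x" "Ck_on n f S"
  shows "Ck_on n g S"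
  using assms(2,3)
proof (induction n arbitrary: f g)
  case 0
  then show ?case by (simp cong: continuous_on_cong)
next
  case (Suc n)
  have der: "(g has_derivative frechet_derivative f (at x)) (at x)" if "x \<in> S" for x
    using that Suc.prems assms(1)
    by (auto intro: has_derivative_transform_within_open simp: frechet_derivative_works)
  then have eq: "frechet_derivative f (at x) v = frechet_derivative g (at x) v" if "x \<in> S" for x v
    using that frechet_derivative_at by metis
  have "Ck_on n (\<lambda>x. frechet_derivative g (at x) v) S" for v
    using Suc.IH[OF eq] Suc.prems(2) by simp
  then show ?case
    using der by (auto simp: differentiable_def)
qed

lemma Ck_on_Suc_hasD:
  assumes "Ck_on (Suc n) f S" "x \<in> S"
  shows "(f has_derivative frechet_derivative f (at x)) (at x)"
  using assms by (simp add: frechet_derivative_works)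

text \<open>By uniqueness of derivatives an explicit formula \<open>f'\<close> may replace
  \<open>frechet_derivative\<close>, which is defined by choice. The closure rules below rest on
  this.\<close>

lemma Ck_on_SucI:
  assumes "open S" and der: "\<And>x. x \<in> S \<Longrightarrow> (f has_derivative f' x) (at x)"
    and "\<And>v. Ck_on n (\<lambda>x. f' x v) S"
  shows "Ck_on (Suc n) f S"
proof -
  have "Ck_on n (\<lambda>x. frechet_derivative f (at x) v) S" for v
    by (rule Ck_on_cong[OF assms(1) _ assms(3)[of v]]) (metis der frechet_derivative_at)
  then show ?thesis
    using der by (auto simp: differentiable_def)
qed

lemma Ck_on_SucD: "Ck_on (Suc n) f S \<Longrightarrow> Ck_on n f S"
proof (induction n arbitrary: f)
  case 0
  then show ?case
    by (auto intro!: continuous_at_imp_continuous_on differentiable_imp_continuous_within)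
next
  case (Suc n)
  then show ?case by (metis Ck_on.simps(2))
qed

lemma Ck_on_const: "open S \<Longrightarrow> Ck_on n (\<lambda>x. c) S"
proof (induction n arbitrary: c)
  case (Suc n)
  show ?case
    by (rule Ck_on_SucI[OF \<open>open S\<close>, where f' = "\<lambda>_ _. 0"]) (auto intro: Suc)
qed simp

lemma Ck_on_linear:
  assumes "open S" "linear f"
  shows "Ck_on n f S"
proof (cases n)
  case 0
  then show ?thesis by (simp add: assms linear_continuous_on linear_linear)
next
  case (Suc m)
  have "Ck_on (Suc m) f S"
    by (rule Ck_on_SucI[where f' = "\<lambda>_. f"])
      (auto intro: assms Ck_on_const linear_imp_has_derivative)
  with Suc show ?thesis by simp
qed

lemma Ck_on_add:
  assumes "open S"
  shows "Ck_on n f S \<Longrightarrow> Ck_on n g S \<Longrightarrow> Ck_on n (\<lambda>x. f x + g x) S"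
proof (induction n arbitrary: f g)
  case 0
  then show ?case by (simp add: continuous_on_add)
next
  case (Suc n)
  show ?case
  proof (rule Ck_on_SucI[OF assms])
    show "((\<lambda>x. f x + g x) has_derivative
        (\<lambda>v. frechet_derivative f (at x) v + frechet_derivative g (at x) v)) (at x)"
      if "x \<in> S" for x
      using that Suc.prems by (intro has_derivative_add Ck_on_Suc_hasD)
    show "Ck_on n (\<lambda>x. frechet_derivative f (at x) v + frechet_derivative g (at x) v) S" for v
      using Suc by simp
  qed
qed

text \<open>Leibniz rule. A general \<open>B\<close> covers real products, scalar multiples and,
  later, the matrix product in coordinates.\<close>

lemma Ck_on_bilinear:
  assumes "bounded_bilinear B" "open S"
  shows "Ck_on n f S \<Longrightarrow> Ck_on n g S \<Longrightarrow> Ck_on n (\<lambda>x. B (f x) (g x)) S"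
proof (induction n arbitrary: f g)
  case 0
  then show ?case by (simp add: bounded_bilinear.continuous_on[OF assms(1)])
next
  case (Suc n)
  show ?case
  proof (rule Ck_on_SucI[OF assms(2)])
    show "((\<lambda>x. B (f x) (g x)) has_derivative
        (\<lambda>v. B (f x) (frechet_derivative g (at x) v) + B (frechet_derivative f (at x) v) (g x))) (at x)"
      if "x \<in> S" for x
      using that Suc.prems by (intro bounded_bilinear.FDERIV[OF assms(1)] Ck_on_Suc_hasD)
    \<comment> \<open>Each summand pairs a function of class C^(n+1), first lowered to C^n, with a
      derivative of class C^n.\<close>
    show "Ck_on n (\<lambda>x. B (f x) (frechet_derivative g (at x) v) +
        B (frechet_derivative f (at x) v) (g x)) S" for v
      using Suc.prems
      by (intro Ck_on_add[OF assms(2)] Suc.IH) (auto dest: Ck_on_SucD simp del: Ck_on.simps(2), simp_all)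
  qed
qed

lemmas Ck_on_mult = Ck_on_bilinear[OF bounded_bilinear_mult]
lemmas Ck_on_scaleR = Ck_on_bilinear[OF bounded_bilinear_scaleR]

lemma Ck_on_uminus:
  fixes f :: "'a::euclidean_space \<Rightarrow> real"
  shows "open S \<Longrightarrow> Ck_on n f S \<Longrightarrow> Ck_on n (\<lambda>x. - f x) S"
  using Ck_on_mult[of S n "\<lambda>_. -1" f] by (simp add: Ck_on_const)

text \<open>The derivative of the reciprocal is again built from the reciprocal and the derivative
  of \<open>f\<close> by products, so the induction hypothesis for the same \<open>f\<close> closes
  the step.\<close>

lemma Ck_on_inverse:
  fixes f :: "'a::euclidean_space \<Rightarrow> real"
  assumes "open S" "\<And>x. x \<in> S \<Longrightarrow> f x \<noteq> 0"
  shows "Ck_on n f S \<Longrightarrow> Ck_on n (\<lambda>x. inverse (f x)) S"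
proof (induction n)
  case 0
  then show ?case using assms(2) by (simp add: continuous_on_inverse)
next
  case (Suc n)
  show ?case
  proof (rule Ck_on_SucI[OF assms(1)])
    show "((\<lambda>x. inverse (f x)) has_derivative
        (\<lambda>v. - (inverse (f x) * frechet_derivative f (at x) v * inverse (f x)))) (at x)"
      if "x \<in> S" for x
      using that Suc.prems assms(2) by (intro Deriv.has_derivative_inverse Ck_on_Suc_hasD)
    show "Ck_on n (\<lambda>x. - (inverse (f x) * frechet_derivative f (at x) v * inverse (f x))) S" for v
      using Suc.IH Ck_on_SucD[OF Suc.prems] Suc.prems
      by (intro Ck_on_uminus Ck_on_mult assms(1)) simp_all
  qed
qed

section \<open>Reduction of the manifold notions to a single coordinate expression\<close>

section \<open>Manifolds with a single chart\<close>

text \<open>\<open>smooth_manifold\<close> asks for the predicate on topologies, while Euclidean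
  spaces bring the type class; the countable basis from the class witnesses the predicate.\<close>

lemma second_countable_euclidean:
  "second_countable (euclidean :: 'a::second_countable_topology topology)"
proof -
  obtain B :: "'a set set" where B: "countable B" "topological_basis B"
    using ex_countable_basis by blast
  have "\<exists>V\<in>B. x \<in> V \<and> V \<subseteq> U" if "open U" "x \<in> U" for U x
    using topological_basisE[OF B(2) that] by metis
  then show ?thesis
    unfolding second_countable_def
    using B topological_basis_open[OF B(2)] by (metis open_openin)
qed

lemma homeomorphic_map_top_of_set:
  assumes "homeomorphism S T f g"
  shows "homeomorphic_map (top_of_set S) (top_of_set T) f"
  unfolding homeomorphic_map_maps homeomorphic_maps_def
  using assms by (intro exI[of _ g]) (auto simp: homeomorphism_def)

lemma inv_into_homeomorphism:
  assumes "homeomorphism S T f g" "y \<in> T"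
  shows "inv_into S f y = g y"
  using assms by (metis homeomorphism_def imageI inv_into_f_eq inj_on_inverseI)

lemma homeomorphism_map_prod:
  assumes "homeomorphism S T f g" "homeomorphism S' T' f' g'"
  shows "homeomorphism (S \<times> S') (T \<times> T') (map_prod f f') (map_prod g g')"
  using assms
  by (auto simp: homeomorphism_def map_prod_def case_prod_unfold image_iff
      intro!: continuous_on_Pair continuous_on_compose2[where f=fst] continuous_on_compose2[where f=snd]
      continuous_on_fst continuous_on_snd continuous_on_id)

text \<open>The only transition map is that of the chart with itself, which is the identity on
  \<open>T\<close>.\<close>

lemma smooth_manifold_single_chart:
  fixes \<phi> :: "'a::euclidean_space \<Rightarrow> 'b::euclidean_space"
  assumes "homeomorphism S T \<phi> \<psi>" "open T"
  shows "smooth_manifold (top_of_set S) {(S, \<phi>)}"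
proof -
  have T: "\<phi> ` S = T" using assms(1) by (simp add: homeomorphism_def)
  have "smooth_on (\<phi> \<circ> inv_into S \<phi>) T"
    unfolding smooth_on_def
    using Ck_on_cong[OF assms(2) _ Ck_on_linear[OF assms(2) linear_id]]
    by (metis T comp_apply f_inv_into_f id_apply)
  then show ?thesis
    using assms(2) homeomorphic_map_top_of_set[OF assms(1)]
    by (simp add: smooth_manifold_def T Hausdorff_space_subtopology
      second_countable_subtopology second_countable_euclidean Hausdorff_space_euclidean subtopology_subtopology)
qed

text \<open>\<open>g\<close> is the coordinate expression of \<open>f\<close>, so everything reduces
  to smoothness of \<open>g\<close> on an open subset of a Euclidean space.\<close>

lemma smooth_map_single_chart:
  assumes hom: "homeomorphism S T \<phi> \<psi>" and hom': "homeomorphism S' T' \<phi>' \<psi>'" and "open T"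
    and g: "smooth_on g T" and gT: "\<And>u. u \<in> T \<Longrightarrow> g u \<in> T'"
    and fg: "\<And>u. u \<in> T \<Longrightarrow> f (\<psi> u) = \<psi>' (g u)"
  shows "smooth_map (top_of_set S) {(S, \<phi>)} (top_of_set S') {(S', \<phi>')} f"
proof -
  have f: "f s = \<psi>' (g (\<phi> s))" "\<phi> s \<in> T" if "s \<in> S" for s
    using that hom fg[of "\<phi> s"] by (auto simp: homeomorphism_def)
  have fS: "f s \<in> S'" if "s \<in> S" for s
    using f[OF that] gT hom' by (metis homeomorphism_def imageI)
  have "continuous_on T g"
    using g Ck_on.simps(1) unfolding smooth_on_def by blast
  then have "continuous_on S (\<lambda>s. \<psi>' (g (\<phi> s)))"
    using hom hom' gT
    by (intro continuous_on_compose2[of T' \<psi>' S] continuous_on_compose2[of T g S \<phi>])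
      (auto simp: homeomorphism_def)
  then have cont: "continuous_on S f"
    using f by (simp cong: continuous_on_cong)
  \<comment> \<open>\<open>f\<close> maps \<open>S\<close> into \<open>S'\<close>, so the coordinate
    expression lives on all of \<open>T\<close>.\<close>
  have T: "\<phi> ` (S \<inter> f -` S') = T"
    using hom fS by (auto simp: homeomorphism_def)
  have "g u = (\<phi>' \<circ> f \<circ> inv_into S \<phi>) u" if "u \<in> T" for u
    using gT[OF that] hom' that
    by (simp add: inv_into_homeomorphism[OF hom] fg homeomorphism_apply2)
  then have "smooth_on (\<phi>' \<circ> f \<circ> inv_into S \<phi>) T"
    using g Ck_on_cong[OF \<open>open T\<close>] unfolding smooth_on_def by metis
  then show ?thesis
    using cont fS by (auto simp: smooth_map_def T)
qed

lemma prod_charts_single: "prod_charts {(W, \<phi>)} {(V, \<psi>)} = {(W \<times> V, map_prod \<phi> \<psi>)}"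
  by (auto simp: prod_charts_def)

section \<open>The stabiliser of a point as a Lie subgroup of dimension 4\<close>

section \<open>Isotropy groups of points\<close>

lemma invertible_mat_1: "invertible (mat 1 :: real^'n^'n)"
  by (simp add: invertible_det_nz)

lemma group_A2: "group A2"
proof (rule groupI)
  fix g assume "g \<in> carrier A2"
  then obtain A v B where g: "g = (A, v)" and AB: "A ** B = mat 1" "B ** A = mat 1"
    by (auto simp: A2_def invertible_def)
  \<comment> \<open>Solving \<open>A p + v = q\<close> for \<open>p\<close> gives the inverse
    \<open>(B, - (B *v v))\<close>; this identity cancels the translation parts.\<close>
  have "B *v v + - (B *v v) = 0" by simp
  then show "\<exists>h\<in>carrier A2. h \<otimes>\<^bsub>A2\<^esub> g = \<one>\<^bsub>A2\<^esub>"
    using AB by (intro bexI[of _ "(B, - (B *v v))"]) (auto simp: A2_def g invertible_def)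
qed (auto simp: A2_def invertible_mult invertible_mat_1 matrix_mul_assoc
    matrix_vector_mul_assoc matrix_vector_right_distrib)

definition isotropy :: "real^2 \<Rightarrow> affine2 set" where
  "isotropy x = {h \<in> carrier A2. aff h x = x}"

lemma subgroup_isotropy: "subgroup (isotropy x) A2"
proof -
  interpret group A2 by (rule group_A2)
  show ?thesis
  proof (rule subgroupI)
    show "isotropy x \<noteq> {}"
      unfolding isotropy_def using one_closed aff_one
      by (metis (mono_tags, lifting) empty_Collect_eq id_apply)
    show "inv\<^bsub>A2\<^esub> h \<in> isotropy x" if "h \<in> isotropy x" for h
    proof -
      have h: "h \<in> carrier A2" "aff h x = x"
        using that by (auto simp: isotropy_def)
      \<comment> \<open>Since \<open>x = aff h x\<close>, the value of the inverse at
        \<open>x\<close> is that of the identity.\<close>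
      then have "aff (inv\<^bsub>A2\<^esub> h) x = aff (inv\<^bsub>A2\<^esub> h \<otimes>\<^bsub>A2\<^esub> h) x"
        unfolding aff_mult by simp
      then show ?thesis
        using h by (simp add: isotropy_def aff_one)
    qed
  qed (auto simp: isotropy_def aff_mult)
qed

text \<open>Row-major coordinates. The model space is \<open>real^4\<close> rather than
  \<open>real^2^2\<close>, so that the dimension 4 shows in the type argument of
  \<open>lie_subgroup\<close>.\<close>

definition mat_of_vec :: "real^4 \<Rightarrow> real^2^2" where
  "mat_of_vec c = (\<chi> i j. if i = 1 then if j = 1 then c $ 1 else c $ 2
                              else if j = 1 then c $ 3 else c $ 4)"

definition vec_of_mat :: "real^2^2 \<Rightarrow> real^4" where
  "vec_of_mat A = (\<chi> i. if i = 1 then A $ 1 $ 1 else if i = 2 then A $ 1 $ 2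
                          else if i = 3 then A $ 2 $ 1 else A $ 2 $ 2)"

lemma mat_of_vec_of_mat [simp]: "mat_of_vec (vec_of_mat A) = A"
  by (simp add: mat_of_vec_def vec_of_mat_def vec_eq_iff forall_2)

lemma vec_of_mat_of_vec [simp]: "vec_of_mat (mat_of_vec c) = c"
  by (simp add: mat_of_vec_def vec_of_mat_def vec_eq_iff forall_4)

lemma linear_mat_of_vec: "linear mat_of_vec"
  by (rule linearI) (simp_all add: mat_of_vec_def vec_eq_iff forall_2)

lemma linear_vec_of_mat: "linear vec_of_mat"
  by (rule linearI) (simp_all add: vec_of_mat_def vec_eq_iff forall_4)

text \<open>Written as a sum of products of linear forms, so that the rules for C^n maps apply
  directly.\<close>

lemma det_mat_of_vec: "det (mat_of_vec c) = c $ 1 * c $ 4 + (- c $ 2) * c $ 3"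
  by (simp add: det_2 mat_of_vec_def)

definition vec_adjugate :: "real^4 \<Rightarrow> real^4" where
  "vec_adjugate c = (\<chi> i. if i = 1 then c $ 4 else if i = 2 then - c $ 2
                           else if i = 3 then - c $ 3 else c $ 1)"

lemma linear_vec_adjugate: "linear vec_adjugate"
  by (rule linearI) (simp_all add: vec_adjugate_def vec_eq_iff forall_4)

lemma mat_of_vec_adjugate_mult:
  "mat_of_vec (vec_adjugate c) ** mat_of_vec c = det (mat_of_vec c) *\<^sub>R mat 1"
  unfolding det_mat_of_vec
  by (simp add: vec_adjugate_def mat_of_vec_def matrix_matrix_mult_def mat_def vec_eq_iff
      forall_2 sum_2 algebra_simps)

text \<open>GL(2, R) in coordinates; the image of the chart.\<close>

definition isotropy_dom :: "(real^4) set" where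
  "isotropy_dom = {c. det (mat_of_vec c) \<noteq> 0}"

text \<open>The map taking \<open>p\<close> to \<open>A (p - x) + x\<close>, where \<open>A\<close>
  has coordinates \<open>c\<close>.\<close>

definition isotropy_param :: "real^2 \<Rightarrow> real^4 \<Rightarrow> affine2" where
  "isotropy_param x c = (mat_of_vec c, x - mat_of_vec c *v x)"

text \<open>Cramer's rule. In size 2 the adjugate is linear in the entries, so smoothness of
  inversion comes down to that of the reciprocal of the determinant.\<close>

definition vec_inverse :: "real^4 \<Rightarrow> real^4" where
  "vec_inverse c = inverse (det (mat_of_vec c)) *\<^sub>R vec_adjugate c"

lemma Ck_on_det: "open S \<Longrightarrow> Ck_on n (\<lambda>c. det (mat_of_vec c)) S"
  unfolding det_mat_of_vec
  by (intro Ck_on_add Ck_on_mult Ck_on_linear linearI) auto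

lemma open_isotropy_dom: "open isotropy_dom"
proof -
  have "continuous_on UNIV (\<lambda>c. det (mat_of_vec c))"
    using Ck_on_det[of UNIV 0] by simp
  then show ?thesis
    unfolding isotropy_dom_def by (intro open_Collect_neq continuous_on_const)
qed

text \<open>The parametrisation is affine in \<open>c\<close>; this is its linear part and hence its
  derivative at every point.\<close>

lemma linear_isotropy_param:
  "linear (\<lambda>c. (mat_of_vec c, - (mat_of_vec c *v x)))"
  by (rule linearI)
    (simp_all add: linear_add[OF linear_mat_of_vec] linear_scale[OF linear_mat_of_vec]
      matrix_vector_mult_add_rdistrib scaleR_matrix_vector_assoc)

lemma isotropy_param_alt:
  "isotropy_param x = (\<lambda>c. (0, x) + (mat_of_vec c, - (mat_of_vec c *v x)))"
  by (simp add: isotropy_param_def fun_eq_iff)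

lemma Ck_on_isotropy_param: "open S \<Longrightarrow> Ck_on n (isotropy_param x) S"
  unfolding isotropy_param_alt
  by (intro Ck_on_add Ck_on_const Ck_on_linear linear_isotropy_param)

lemma isotropy_param_has_derivative:
  "(isotropy_param x has_derivative (\<lambda>v. (mat_of_vec v, - (mat_of_vec v *v x)))) (at c)"
  using has_derivative_add[OF has_derivative_const
      linear_imp_has_derivative[OF linear_isotropy_param], of "(0, x)" x "at c"]
  unfolding isotropy_param_alt by simp

lemma isotropy_param_in: "c \<in> isotropy_dom \<Longrightarrow> isotropy_param x c \<in> isotropy x"
  by (simp add: isotropy_def isotropy_param_def isotropy_dom_def A2_def aff_def invertible_det_nz)

text \<open>The equation \<open>A x + v = x\<close> determines \<open>v\<close> from
  \<open>A\<close>, so the linear part alone is a global chart.\<close>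

lemma homeomorphism_isotropy:
  "homeomorphism (isotropy x) isotropy_dom (vec_of_mat \<circ> fst) (isotropy_param x)"
proof -
  have inv: "isotropy_param x (vec_of_mat (fst h)) = h" "vec_of_mat (fst h) \<in> isotropy_dom"
    if "h \<in> isotropy x" for h
    using that
    by (auto simp: isotropy_def isotropy_param_def isotropy_dom_def A2_def aff_def
        invertible_det_nz algebra_simps)
  have "continuous_on isotropy_dom (isotropy_param x)"
    using Ck_on_isotropy_param[OF open_isotropy_dom, of 0] by simp
  moreover have "continuous_on (isotropy x) (vec_of_mat \<circ> fst)"
    by (intro linear_continuous_on)
      (simp add: linear_compose linear_fst linear_vec_of_mat flip: linear_conv_bounded_linear)
  moreover have "vec_of_mat (fst (isotropy_param x c)) = c" for c
    by (simp add: isotropy_param_def)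
  ultimately show ?thesis
    using inv isotropy_param_in
    by (intro homeomorphismI) (auto simp del: o_apply simp: comp_def)
qed

text \<open>Composition multiplies linear parts, and the composite still fixes \<open>x\<close>, so
  its translation part is the prescribed one.\<close>

lemma isotropy_param_mult:
  "isotropy_param x c \<otimes>\<^bsub>A2\<^esub> isotropy_param x d =
    isotropy_param x (vec_of_mat (mat_of_vec c ** mat_of_vec d))"
  by (simp add: isotropy_param_def A2_def matrix_vector_mult_diff_distrib matrix_vector_mul_assoc)

lemma bounded_bilinear_vec_mult:
  "bounded_bilinear (\<lambda>c d. vec_of_mat (mat_of_vec c ** mat_of_vec d))"
proof -
  have add: "(A + B) ** C = A ** C + B ** C" for A B C :: "real^2^2"
    by (simp add: matrix_matrix_mult_def vec_eq_iff distrib_right sum.distrib)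
  have "linear (\<lambda>d. vec_of_mat (mat_of_vec c ** mat_of_vec d))"
    "linear (\<lambda>c. vec_of_mat (mat_of_vec c ** mat_of_vec d))" for c d
    by (rule linearI; simp add: linear_add[OF linear_mat_of_vec] linear_scale[OF linear_mat_of_vec]
        linear_add[OF linear_vec_of_mat] linear_scale[OF linear_vec_of_mat]
        matrix_add_ldistrib add matrix_scalar_ac flip: scalar_matrix_assoc)+
  \<comment> \<open>In finite dimension bilinear maps are bounded.\<close>
  then show ?thesis
    by (simp add: bilinear_def flip: bilinear_conv_bounded_bilinear)
qed

lemma isotropy_param_inverse:
  assumes "c \<in> isotropy_dom"
  shows "vec_inverse c \<in> isotropy_dom"
    and "inv\<^bsub>A2\<lparr>carrier := isotropy x\<rparr>\<^esub> (isotropy_param x c) = isotropy_param x (vec_inverse c)"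
proof -
  have mult: "mat_of_vec (vec_inverse c) ** mat_of_vec c = mat 1"
    using assms mat_of_vec_adjugate_mult[of c]
    by (simp add: vec_inverse_def isotropy_dom_def linear_scale[OF linear_mat_of_vec]
        flip: scalar_matrix_assoc)
  \<comment> \<open>Taking determinants shows that the candidate inverse is itself
    invertible.\<close>
  then have "det (mat_of_vec (vec_inverse c)) * det (mat_of_vec c) = 1"
    by (metis det_I det_mul)
  then show dom: "vec_inverse c \<in> isotropy_dom"
    by (auto simp: isotropy_dom_def)
  \<comment> \<open>\<open>m_inv\<close> depends on the carrier, so the inverse is identified in the
    restricted group, where a left inverse suffices.\<close>
  interpret H: group "A2\<lparr>carrier := isotropy x\<rparr>"
    using subgroup.subgroup_is_group[OF subgroup_isotropy group_A2] .
  show "inv\<^bsub>A2\<lparr>carrier := isotropy x\<rparr>\<^esub> (isotropy_param x c) = isotropy_param x (vec_inverse c)"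
  proof (rule H.inv_equality)
    have "isotropy_param x (vec_of_mat (mat 1)) = \<one>\<^bsub>A2\<^esub>"
      by (simp add: isotropy_param_def A2_def)
    then show "isotropy_param x (vec_inverse c) \<otimes>\<^bsub>A2\<lparr>carrier := isotropy x\<rparr>\<^esub> isotropy_param x c
        = \<one>\<^bsub>A2\<lparr>carrier := isotropy x\<rparr>\<^esub>"
      by (simp add: isotropy_param_mult mult)
  qed (use assms dom isotropy_param_in in auto)
qed

text \<open>In the global chart multiplication is a bilinear map and inversion is Cramer's rule,
  both smooth on the open set \<open>isotropy_dom\<close>.\<close>

lemma lie_group_isotropy:
  "lie_group (A2\<lparr>carrier := isotropy x\<rparr>) (top_of_set (isotropy x)) {(isotropy x, vec_of_mat \<circ> fst)}"
  unfolding lie_group_def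
proof (intro conjI)
  show "group (A2\<lparr>carrier := isotropy x\<rparr>)"
    using subgroup.subgroup_is_group[OF subgroup_isotropy group_A2] .
  show "smooth_manifold (top_of_set (isotropy x)) {(isotropy x, vec_of_mat \<circ> fst)}"
    by (rule smooth_manifold_single_chart[OF homeomorphism_isotropy open_isotropy_dom])
  \<comment> \<open>The product of subspace topologies is the subspace topology of the product, and
    the product atlas again has one chart, so the single-chart criterion also covers
    multiplication.\<close>
  have "smooth_map (top_of_set (isotropy x \<times> isotropy x))
     {(isotropy x \<times> isotropy x, map_prod (vec_of_mat \<circ> fst) (vec_of_mat \<circ> fst))}
     (top_of_set (isotropy x)) {(isotropy x, vec_of_mat \<circ> fst)} (\<lambda>(g, h). g \<otimes>\<^bsub>A2\<^esub> h)"
  proof (rule smooth_map_single_chart[OF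
        homeomorphism_map_prod[OF homeomorphism_isotropy homeomorphism_isotropy]
        homeomorphism_isotropy open_Times[OF open_isotropy_dom open_isotropy_dom]])
    show "smooth_on (\<lambda>u. vec_of_mat (mat_of_vec (fst u) ** mat_of_vec (snd u)))
        (isotropy_dom \<times> isotropy_dom)"
      unfolding smooth_on_def
      by (intro allI Ck_on_bilinear[OF bounded_bilinear_vec_mult] Ck_on_linear linear_fst linear_snd
          open_Times open_isotropy_dom)
  qed (auto simp: isotropy_param_mult isotropy_dom_def det_mul)
  then show "smooth_map (prod_topology (top_of_set (isotropy x)) (top_of_set (isotropy x)))
     (prod_charts {(isotropy x, vec_of_mat \<circ> fst)} {(isotropy x, vec_of_mat \<circ> fst)})
     (top_of_set (isotropy x)) {(isotropy x, vec_of_mat \<circ> fst)}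
     (\<lambda>(g, h). g \<otimes>\<^bsub>A2\<lparr>carrier := isotropy x\<rparr>\<^esub> h)"
    by (simp add: prod_charts_single)
  show "smooth_map (top_of_set (isotropy x)) {(isotropy x, vec_of_mat \<circ> fst)}
     (top_of_set (isotropy x)) {(isotropy x, vec_of_mat \<circ> fst)} (m_inv (A2\<lparr>carrier := isotropy x\<rparr>))"
  proof (rule smooth_map_single_chart[OF homeomorphism_isotropy homeomorphism_isotropy open_isotropy_dom])
    show "smooth_on vec_inverse isotropy_dom"
      unfolding smooth_on_def vec_inverse_def
      by (intro allI Ck_on_scaleR Ck_on_inverse Ck_on_det Ck_on_linear linear_vec_adjugate
          open_isotropy_dom) (simp add: isotropy_dom_def)
  qed (auto simp: isotropy_param_inverse)
qed simp

text \<open>In the charts the inclusion is the affine map \<open>isotropy_param x\<close>. Its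
  derivative is injective because the first component is the injective map
  \<open>mat_of_vec\<close>.\<close>

lemma lie_subgroup_isotropy:
  "lie_subgroup TYPE(real^4) (isotropy x) A2 A2_topology A2_charts"
proof -
  have smooth: "smooth_map (top_of_set (isotropy x)) {(isotropy x, vec_of_mat \<circ> fst)}
      (top_of_set (carrier A2)) {(carrier A2, id)} id"
  proof (rule smooth_map_single_chart[OF homeomorphism_isotropy _ open_isotropy_dom])
    show "homeomorphism (carrier A2) (carrier A2) id id"
      by (simp add: homeomorphism_def)
    show "smooth_on (isotropy_param x) isotropy_dom"
      by (simp add: smooth_on_def Ck_on_isotropy_param open_isotropy_dom)
  qed (use isotropy_param_in in \<open>auto simp: isotropy_def\<close>)
  have inj: "inj (frechet_derivative (id \<circ> id \<circ> inv_into (isotropy x) (vec_of_mat \<circ> fst)) (at u))"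
    if "u \<in> isotropy_dom" for u
  proof -
    \<comment> \<open>\<open>inv_into\<close> is known to equal the parametrisation only on
      \<open>isotropy_dom\<close>; openness of that set lets the derivative carry over.\<close>
    have "((id \<circ> id \<circ> inv_into (isotropy x) (vec_of_mat \<circ> fst)) has_derivative
        (\<lambda>v. (mat_of_vec v, - (mat_of_vec v *v x)))) (at u)"
      by (rule has_derivative_transform_within_open[OF isotropy_param_has_derivative
            open_isotropy_dom that])
        (simp add: inv_into_homeomorphism[OF homeomorphism_isotropy])
    then have "frechet_derivative (id \<circ> id \<circ> inv_into (isotropy x) (vec_of_mat \<circ> fst)) (at u) =
        (\<lambda>v. (mat_of_vec v, - (mat_of_vec v *v x)))"
      by (rule frechet_derivative_at[symmetric])
    moreover have "inj mat_of_vec"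
      by (rule inj_on_inverseI[of _ vec_of_mat]) simp
    ultimately show ?thesis
      by (simp add: inj_on_def)
  qed
  have "(vec_of_mat \<circ> fst) ` (isotropy x \<inter> id -` carrier A2) \<subseteq> isotropy_dom"
    using homeomorphism_image1[OF homeomorphism_isotropy, of x] by blast
  with smooth inj have "immersion (top_of_set (isotropy x)) {(isotropy x, vec_of_mat \<circ> fst)}
      A2_topology A2_charts id"
    unfolding immersion_def A2_topology_def A2_charts_def by (auto simp del: o_apply id_apply)
  then show ?thesis
    unfolding lie_subgroup_def using subgroup_isotropy lie_group_isotropy by metis
qed

section \<open>Lines through a fixed point and the affine maps preserving them\<close>

section \<open>Radial line fields\<close>

lemma frechet_derivative_aff: "frechet_derivative (aff g) (at p) = (*v) (fst g)"
proof -
  have "(aff g has_derivative (*v) (fst g)) (at p)"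
    using has_derivative_add[OF linear_imp_has_derivative[OF matrix_vector_mul_linear]
        has_derivative_const, of "fst g" "snd g" "at p"]
    by (simp add: aff_def[abs_def])
  then show ?thesis by (rule frechet_derivative_at[symmetric])
qed

text \<open>The vector \<open>p - x\<close> has slope \<open>f p\<close>, and its first coordinate
  is nonzero, so it spans the kernel.\<close>

lemma line_field_radial:
  assumes "p $ 1 \<noteq> x $ 1" "f p = inverse (p $ 1 - x $ 1) * (p $ 2 - x $ 2)"
  shows "line_field f p = range (\<lambda>t. t *\<^sub>R (p - x))"
proof (intro equalityI subsetI)
  fix v assume "v \<in> line_field f p"
  then have "v $ 2 = f p * v $ 1"
    by (simp add: line_field_def)
  \<comment> \<open>The coefficient is found by comparing first coordinates.\<close>
  then have "v = (v $ 1 / (p $ 1 - x $ 1)) *\<^sub>R (p - x)"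
    using assms by (simp add: vec_eq_iff forall_2 divide_inverse)
  then show "v \<in> range (\<lambda>t. t *\<^sub>R (p - x))" by blast
next
  fix v assume "v \<in> range (\<lambda>t. t *\<^sub>R (p - x))"
  moreover have "f p * (p $ 1 - x $ 1) = p $ 2 - x $ 2"
    using assms by simp
  ultimately show "v \<in> line_field f p"
    by (auto simp: line_field_def mult.left_commute[of "f p"])
qed

text \<open>As \<open>h\<close> is affine and fixes \<open>x\<close>, its linear part sends
  \<open>p - x\<close> to \<open>aff h p - x\<close>, hence one spanning vector to the
  other.\<close>

lemma admits_isotropy:
  assumes "\<And>p. p \<in> U \<Longrightarrow> p $ 1 \<noteq> x $ 1"
    and "\<And>p. p \<in> U \<Longrightarrow> f p = inverse (p $ 1 - x $ 1) * (p $ 2 - x $ 2)"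
  shows "admits f U (isotropy x)"
  unfolding admits_def
proof (intro ballI impI)
  fix h p assume h: "h \<in> isotropy x" and p: "p \<in> U" "aff h p \<in> U"
  have "fst h *v (p - x) = aff h p - aff h x"
    by (simp add: aff_def matrix_vector_mult_diff_distrib)
  then have "fst h *v (p - x) = aff h p - x"
    using h by (simp add: isotropy_def)
  then show "frechet_derivative (aff h) (at p) ` line_field f p = line_field f (aff h p)"
    using assms p
    by (simp add: frechet_derivative_aff line_field_radial[where x = x] image_image
        matrix_vector_mult_scaleR)
qed

text \<open>A translation has the identity as derivative, so only the slopes have to match; one
  translation with \<open>V = U\<close> serves every point.\<close>

lemma transformable_translation:
  assumes "open U" "\<And>p. p \<in> U \<Longrightarrow> p + v \<in> U' \<and> F (p + v) = f p"
  shows "transformable f U F U'"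
  unfolding transformable_def
proof
  fix p assume "p \<in> U"
  have "(mat 1, v) \<in> carrier A2"
    by (simp add: A2_def invertible_mat_1)
  moreover have "aff (mat 1, v) q = q + v" for q
    by (simp add: aff_def)
  ultimately show "\<exists>V. \<exists>g\<in>carrier A2. open V \<and> p \<in> V \<and> V \<subseteq> U \<and> aff g ` V \<subseteq> U' \<and>
     (\<forall>q\<in>V. frechet_derivative (aff g) (at q) ` line_field f q = line_field F (aff g q))"
    using \<open>p \<in> U\<close> assms
    by (intro exI[of _ U] bexI[of _ "(mat 1, v)"])
      (auto simp: frechet_derivative_aff line_field_def)
qed

theorem theorem4p2:
  fixes a b :: real and U :: "(real^2) set" and f :: "real^2 \<Rightarrow> real"
  assumes U: "U \<in> components {p :: real^2. p $ 1 \<noteq> - a}"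
    and f: "f = (\<lambda>p. inverse (p $ 1 + a) * (p $ 2 + b))"
  shows "(\<exists>H. lie_subgroup TYPE(real^4) H A2 A2_topology A2_charts \<and> admits f U H) \<and>
    transformable f U (\<lambda>p. inverse (p $ 1) * p $ 2) {p. p $ 1 \<noteq> 0}"
proof
  \<comment> \<open>\<open>U\<close> avoids the vertical line through (-a, -b), so on
    \<open>U\<close> the slope formula never meets the default value
    \<open>inverse 0 = 0\<close>.\<close>
  have dom: "p $ 1 \<noteq> - a" if "p \<in> U" for p
    using in_components_subset[OF U] that by blast
  have "open {p :: real^2. p $ 1 \<noteq> - a}"
    by (intro open_Collect_neq continuous_intros)
  \<comment> \<open>Components of an open set are open, which lets \<open>U\<close> be the
    neighbourhood of each of its points.\<close>
  then have "open U"
    using U open_components by blast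
  have "admits f U (isotropy (vector [- a, - b]))"
    by (rule admits_isotropy) (simp_all add: f dom)
  then show "\<exists>H. lie_subgroup TYPE(real^4) H A2 A2_topology A2_charts \<and> admits f U H"
    using lie_subgroup_isotropy by blast
  show "transformable f U (\<lambda>p. inverse (p $ 1) * p $ 2) {p. p $ 1 \<noteq> 0}"
    by (rule transformable_translation[OF \<open>open U\<close>, where v = "vector [a, b]"])
      (use dom f in \<open>auto simp: eq_neg_iff_add_eq_0\<close>)
qed

end
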